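(* Let the random variable $X \in \mathbb{R}^p$ follow an elliptical distribution $F$ with center $\mu$ and covariance matrix $\Sigma$ with spectral decomposition $\Sigma = \Gamma\Lambda\Gamma^T$, where $\Gamma$ is orthogonal and $\Lambda = \mathrm{diag}(\lambda_1,\dots,\lambda_p)$ with $\lambda_i>0$. Given a depth function $D_X(\cdot)$ with an associated htped function $\tilde D_X(\cdot)$, let $\tilde X = \tilde D_X(X)\, S(X-\mu)$ be the transformed random variable (multivariate rank vector). Then the covariance matrix of $\tilde X$ is $$\mathrm{Cov}(\tilde X) = \Gamma \Lambda_{D,S}\Gamma^T, \qquad \Lambda_{D,S} = \mathbb{E}_z\left[ (\tilde D_Z(z))^2\, \frac{\Lambda^{1/2} z z^T \Lambda^{1/2}}{z^T\Lambda z}\right],$$ where $z = (z_1,\dots,z_p)^T \sim N(0, I_p)$, so that $\Lambda_{D,S}$ is a diagonal matrix with diagonal entries $$\lambda_{D,S,i} = \mathbb{E}_Z\left[ \frac{(\tilde D_Z(z))^2 \lambda_i z_i^2}{\sum_{j=1}^p \lambda_j z_j^2}\right],\qquad i=1,\dots,p.$$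
   Context: Elliptical distribution: $X$ has density $x\mapsto |\Sigma|^{-1/2} f((x-\mu)^T\Sigma^{-1}(x-\mu))$ for some function $f$, with center $\mu$ and covariance matrix $\Sigma$. Spatial sign: $S(x) = x/\|x\|$ for $x\neq 0$, and $S(0)=0$. Depth function: a real-valued function $D(x,F_X)$ of a point $x\in\mathbb{R}^p$ and a probability distribution $F_X$ in a class $\mathcal F$, satisfying (i) affine invariance: $D(Ax+b, F_{AX+b}) = D(x,F_X)$ for all nonsingular $A$ and $b\in\mathbb{R}^p$; (ii) $\sup_{F\in\mathcal F}\sup_{x} D(x,F)<\infty$; (iii) $D(x,F)\to 0$ as $\|x\|\to\infty$. Write $D_X(x)=D(x,F_X)$, where $F_X$ is the distribution of $X$. Htped function: $\tilde D(x,F) = h(D(x,F))$, where $h$ is bounded and monotonically decreasing and $\sup_x \tilde D(x,F)<\infty$. Write $\tilde D_X(x) = \tilde D(x,F_X)$. $Z$ denotes the normalized version of $X$, related to it by $X=\Gamma\Lambda^{1/2}Z+\mu$, and $\tilde D_Z$ is the htped function with respect to the distribution of $Z$.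
   Formalization: For non-Gaussian X the formula with z ~ N(0,I_p) is false (e.g. p=1, X uniform); here z has the law of Z, with N(0,I_p) used for z only when that is the law of Z, and in general only for the direction of z. The htped function of X is assumed Borel measurable. *)

theory Defs
  imports "HOL-Probability.Probability"
begin

text \<open>\<open>X\<close> is elliptical with center \<open>\<mu>\<close> and covariance matrix \<open>\<Sigma>\<close>. These are the parameters of
  the density; no moments of \<open>X\<close> are assumed to exist.\<close>

definition elliptical ::
    "'a measure \<Rightarrow> ('a \<Rightarrow> real ^ 'p) \<Rightarrow> real ^ 'p \<Rightarrow> real ^ 'p ^ 'p \<Rightarrow> bool" where
  "elliptical M X \<mu> \<Sigma> \<longleftrightarrow>
     (\<exists>f :: real \<Rightarrow> real. (\<forall>t\<ge>0. 0 \<le> f t) \<and>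
        distributed M lborel X
          (\<lambda>x. ennreal (det \<Sigma> powr (- 1 / 2) * f ((x - \<mu>) \<bullet> (matrix_inv \<Sigma> *v (x - \<mu>))))))"

definition std_normal_vec :: "(real ^ 'p) measure" where
  "std_normal_vec = density lborel (\<lambda>z. ennreal (\<Prod>i\<in>UNIV. std_normal_density (z $ i)))"

text \<open>The spatial sign is the library's \<open>sgn\<close>: \<open>sgn x = x /\<^sub>R norm x\<close>, so \<open>sgn 0 = 0\<close>.\<close>

abbreviation spatial_sign :: "real ^ 'p \<Rightarrow> real ^ 'p" where
  "spatial_sign \<equiv> sgn"

text \<open>A depth function only matters on its class \<open>\<F>\<close> of distributions. That \<open>\<F>\<close> is closed under
  nonsingular affine maps is what makes the affine invariance equation meaningful.\<close>

definition depth_function ::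
    "(real ^ 'p) measure set \<Rightarrow> (real ^ 'p \<Rightarrow> (real ^ 'p) measure \<Rightarrow> real) \<Rightarrow> bool" where
  "depth_function \<F> D \<longleftrightarrow>
     (\<forall>F\<in>\<F>. prob_space F \<and> sets F = sets borel) \<and>
     (\<forall>F\<in>\<F>. \<forall>(A :: real ^ 'p ^ 'p) b. invertible A \<longrightarrow>
        distr F borel (\<lambda>x. A *v x + b) \<in> \<F> \<and>
        (\<forall>x. D (A *v x + b) (distr F borel (\<lambda>x. A *v x + b)) = D x F)) \<and>
     bdd_above {D x F | x F. F \<in> \<F>} \<and>
     (\<forall>F\<in>\<F>. ((\<lambda>x. D x F) \<longlongrightarrow> 0) at_infinity)"

definition htped ::
    "(real \<Rightarrow> real) \<Rightarrow> (real ^ 'p \<Rightarrow> (real ^ 'p) measure \<Rightarrow> real)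
       \<Rightarrow> real ^ 'p \<Rightarrow> (real ^ 'p) measure \<Rightarrow> real" where
  "htped h D x F = h (D x F)"

text \<open>Boundedness and monotonicity of \<open>h\<close> concern the values of the depth function only, so that
  for instance \<open>h d = c - d\<close> and \<open>h d = exp (- d)\<close> are both admitted.\<close>

definition htped_transform ::
    "(real ^ 'p) measure set \<Rightarrow> (real ^ 'p \<Rightarrow> (real ^ 'p) measure \<Rightarrow> real)
       \<Rightarrow> (real \<Rightarrow> real) \<Rightarrow> bool" where
  "htped_transform \<F> D h \<longleftrightarrow>
     bounded (h ` {D x F | x F. F \<in> \<F>}) \<and>
     monotone_on {D x F | x F. F \<in> \<F>} (\<le>) (\<ge>) h \<and>
     (\<forall>F\<in>\<F>. bdd_above (range (\<lambda>x. htped h D x F)))"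

definition diag_mat :: "real ^ 'p \<Rightarrow> real ^ 'p ^ 'p" where
  "diag_mat v = (\<chi> i j. if i = j then v $ i else 0)"

definition cov_matrix :: "'a measure \<Rightarrow> ('a \<Rightarrow> real ^ 'p) \<Rightarrow> real ^ 'p ^ 'p" where
  "cov_matrix M Y =
     (\<chi> i j. LINT \<omega>|M. (Y \<omega> $ i - (LINT \<omega>'|M. Y \<omega>' $ i)) * (Y \<omega> $ j - (LINT \<omega>'|M. Y \<omega>' $ j)))"

definition rank_vector ::
    "(real \<Rightarrow> real) \<Rightarrow> (real ^ 'p \<Rightarrow> (real ^ 'p) measure \<Rightarrow> real)
       \<Rightarrow> 'a measure \<Rightarrow> ('a \<Rightarrow> real ^ 'p) \<Rightarrow> real ^ 'p \<Rightarrow> 'a \<Rightarrow> real ^ 'p" where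
  "rank_vector h D M X \<mu> \<omega> = htped h D (X \<omega>) (distr M borel X) *\<^sub>R spatial_sign (X \<omega> - \<mu>)"

text \<open>The matrix \<open>\<Lambda>\<^sup>1\<^sup>/\<^sup>2 z z\<^sup>T \<Lambda>\<^sup>1\<^sup>/\<^sup>2 / (z\<^sup>T \<Lambda> z)\<close> for \<open>\<Lambda> = diag_mat lam\<close>, and \<open>0\<close> at \<open>z = 0\<close>.\<close>

definition sign_matrix :: "real ^ 'p \<Rightarrow> real ^ 'p \<Rightarrow> real ^ 'p ^ 'p" where
  "sign_matrix lam z =
     (1 / (z \<bullet> (diag_mat lam *v z))) *\<^sub>R
       (diag_mat (\<chi> i. sqrt (lam $ i)) ** (columnvector z :: real ^ 1 ^ 'p) ** (rowvector z :: real ^ 'p ^ 1)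
          ** diag_mat (\<chi> i. sqrt (lam $ i)))"

text \<open>\<open>Lambda_DS h D PZ lam \<nu>\<close>: the htped function is taken with respect to the law \<open>PZ\<close>, while
  the integration variable \<open>z\<close> has law \<open>\<nu>\<close>.\<close>

definition Lambda_DS ::
    "(real \<Rightarrow> real) \<Rightarrow> (real ^ 'p \<Rightarrow> (real ^ 'p) measure \<Rightarrow> real)
       \<Rightarrow> (real ^ 'p) measure \<Rightarrow> real ^ 'p \<Rightarrow> (real ^ 'p) measure \<Rightarrow> real ^ 'p ^ 'p" where
  "Lambda_DS h D PZ lam \<nu> = (LINT z|\<nu>. (htped h D z PZ)\<^sup>2 *\<^sub>R sign_matrix lam z)"

definition lambda_DS ::
    "(real \<Rightarrow> real) \<Rightarrow> (real ^ 'p \<Rightarrow> (real ^ 'p) measure \<Rightarrow> real)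
       \<Rightarrow> (real ^ 'p) measure \<Rightarrow> real ^ 'p \<Rightarrow> (real ^ 'p) measure \<Rightarrow> real ^ 'p" where
  "lambda_DS h D PZ lam \<nu> =
     (\<chi> i. LINT z|\<nu>. (htped h D z PZ)\<^sup>2 * lam $ i * (z $ i)\<^sup>2 / (\<Sum>j\<in>UNIV. lam $ j * (z $ j)\<^sup>2))"

end

theory Submission
  imports Defs
begin

text \<open>Write \<open>X - \<mu> = A Z\<close> with \<open>A = \<Gamma> \<Lambda>\<^sup>1\<^sup>/\<^sup>2\<close>. The density of \<open>Z\<close> depends on the norm only, so its law is
  orthogonally invariant, and by affine invariance of the depth so is the htped function \<open>\<phi>\<close> of
  \<open>Z\<close>. Hence the rank vector is \<open>\<Gamma> (\<phi>(Z) s(Z))\<close> with \<open>s(z) = S(\<Lambda>\<^sup>1\<^sup>/\<^sup>2 z)\<close>, and reflecting a single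
  coordinate kills its mean and the off-diagonal second moments. The direction may be taken from a
  Gaussian because the integral of a radial function \<open>w\<close> times a function \<open>\<psi>\<close> that is homogeneous of
  degree \<open>0\<close> is a constant depending on \<open>\<psi>\<close> alone times the integral of \<open>w\<close>: the image of
  \<open>\<psi> dx\<close> under the norm gives \<open>[0, r]\<close> a mass proportional to the volume of the ball of radius
  \<open>r\<close>.\<close>

section \<open>Linear changes of variables\<close>

lemma borel_measurable_linear:
  fixes T :: "'a::euclidean_space \<Rightarrow> 'b::euclidean_space"
  assumes "linear T"
  shows "T \<in> borel_measurable borel"
  using assms by (intro borel_measurable_continuous_onI linear_continuous_on)
    (simp add: linear_conv_bounded_linear)

text \<open>For these two values of \<open>c\<close> the Jacobian factor of the affine map is
  1.\<close>

lemma nn_integral_lborel_reflect_translate: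
  fixes f :: "'a::euclidean_space \<Rightarrow> ennreal"
  assumes [measurable]: "f \<in> borel_measurable borel" and c: "c = 1 \<or> c = -1"
  shows "(\<integral>\<^sup>+x. f (t + c *\<^sub>R x) \<partial>lborel) = (\<integral>\<^sup>+x. f x \<partial>lborel)"
proof -
  have "(\<integral>\<^sup>+x. f x \<partial>lborel)
      = (\<integral>\<^sup>+x. f x \<partial>density (distr lborel borel (\<lambda>x. t + c *\<^sub>R x)) (\<lambda>_. \<bar>c\<bar> ^ DIM('a)))"
    using c by (subst lborel_affine[of c t, symmetric]) auto
  also have "\<dots> = (\<integral>\<^sup>+x. f (t + c *\<^sub>R x) \<partial>lborel)"
    using c by (subst nn_integral_density) (auto simp: nn_integral_distr)
  finally show ?thesis by simp
qed

text \<open>Uniqueness of Haar measure in disguise. The library's change of variables for linear maps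
  needs a well-ordered index type, so it does not apply to \<open>real ^ 'p\<close> with \<open>'p\<close> merely finite.\<close>

lemma nn_integral_lborel_linear_cross:
  fixes T :: "'a::euclidean_space \<Rightarrow> 'a" and f g :: "'a \<Rightarrow> ennreal"
  assumes T: "linear T" "inj T"
    and [measurable]: "f \<in> borel_measurable borel" "g \<in> borel_measurable borel"
  shows "(\<integral>\<^sup>+x. f (T x) \<partial>lborel) * (\<integral>\<^sup>+y. g y \<partial>lborel)
    = (\<integral>\<^sup>+x. g (T x) \<partial>lborel) * (\<integral>\<^sup>+y. f y \<partial>lborel)"
proof -
  \<comment> \<open>\<open>S\<close> inverts \<open>T\<close>, so a translation by \<open>y\<close>
    outside \<open>T\<close> is a translation by \<open>S y\<close> inside it, which Lebesgue
    measure does not see.\<close>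
  obtain S where S: "linear S" "\<And>x. T (S x) = x"
    using linear_injective_isomorphism[OF T] by auto
  have [measurable]: "T \<in> borel_measurable borel"
    using T(1) by (rule borel_measurable_linear)
  have shift: "(\<integral>\<^sup>+x. f (T x) \<partial>lborel) = (\<integral>\<^sup>+x. f (T x + y) \<partial>lborel)" for y
  proof -
    have "(\<integral>\<^sup>+x. f (T x) \<partial>lborel) = (\<integral>\<^sup>+x. f (T (S y + 1 *\<^sub>R x)) \<partial>lborel)"
      by (subst nn_integral_lborel_reflect_translate[of "\<lambda>x. f (T x)"]) auto
    then show ?thesis
      by (simp add: linear_add[OF T(1)] S(2) add.commute)
  qed
  have reflect: "(\<integral>\<^sup>+x. g (y - T x) \<partial>lborel) = (\<integral>\<^sup>+x. g (T x) \<partial>lborel)" for y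
  proof -
    have "(\<integral>\<^sup>+x. g (T x) \<partial>lborel) = (\<integral>\<^sup>+x. g (T (S y + (-1) *\<^sub>R x)) \<partial>lborel)"
      by (subst nn_integral_lborel_reflect_translate[of "\<lambda>x. g (T x)"]) auto
    then show ?thesis
      by (simp add: linear_diff[OF T(1)] S(2))
  qed
  have "(\<integral>\<^sup>+x. f (T x) \<partial>lborel) * (\<integral>\<^sup>+y. g y \<partial>lborel)
      = (\<integral>\<^sup>+y. (\<integral>\<^sup>+x. f (T x + y) \<partial>lborel) * g y \<partial>lborel)"
    by (subst nn_integral_cmult[symmetric]) (auto simp: shift[symmetric])
  also have "\<dots> = (\<integral>\<^sup>+y. (\<integral>\<^sup>+x. f (T x + y) * g y \<partial>lborel) \<partial>lborel)"
    by (subst nn_integral_multc) auto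
  also have "\<dots> = (\<integral>\<^sup>+x. (\<integral>\<^sup>+y. f (T x + y) * g y \<partial>lborel) \<partial>lborel)"
    by (subst lborel_pair.Fubini') auto
  \<comment> \<open>For fixed \<open>x\<close> the translation of \<open>y\<close> by
    \<open>T x\<close> moves the shift from \<open>f\<close> to \<open>g\<close>. After another
    exchange of integrals, \<open>reflect\<close> separates the two functions.\<close>
  also have "\<dots> = (\<integral>\<^sup>+x. (\<integral>\<^sup>+y. f y * g (y - T x) \<partial>lborel) \<partial>lborel)"
  proof (rule nn_integral_cong)
    fix x
    have "(\<integral>\<^sup>+y. f (T x + 1 *\<^sub>R y) * g (T x + 1 *\<^sub>R y - T x) \<partial>lborel)
        = (\<integral>\<^sup>+y. f y * g (y - T x) \<partial>lborel)"
      by (rule nn_integral_lborel_reflect_translate) auto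
    then show "(\<integral>\<^sup>+y. f (T x + y) * g y \<partial>lborel) = (\<integral>\<^sup>+y. f y * g (y - T x) \<partial>lborel)"
      by simp
  qed
  also have "\<dots> = (\<integral>\<^sup>+y. (\<integral>\<^sup>+x. f y * g (y - T x) \<partial>lborel) \<partial>lborel)"
    by (subst lborel_pair.Fubini') auto
  also have "\<dots> = (\<integral>\<^sup>+y. f y * (\<integral>\<^sup>+x. g (T x) \<partial>lborel) \<partial>lborel)"
    by (subst nn_integral_cmult) (auto simp: reflect)
  also have "\<dots> = (\<integral>\<^sup>+x. g (T x) \<partial>lborel) * (\<integral>\<^sup>+y. f y \<partial>lborel)"
    by (subst nn_integral_multc) (auto simp: mult.commute)
  finally show ?thesis .
qed

text \<open>Lets the volume of a ball act as a normalizer that can be cancelled in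
  \<open>ennreal\<close>.\<close>

lemma emeasure_lborel_cball_pos_finite:
  fixes c :: "'a::euclidean_space"
  assumes "0 < r"
  shows "emeasure lborel (cball c r) \<noteq> 0" "emeasure lborel (cball c r) \<noteq> \<top>"
proof -
  show "emeasure lborel (cball c r) \<noteq> \<top>"
    using emeasure_lborel_cball_finite[of c r] by auto
  have "emeasure lborel (ball c r) \<noteq> 0"
    using assms open_not_negligible[of "ball c r"] negligible_iff_null_sets[of "ball c r"]
    by (auto simp: null_sets_def)
  moreover have "emeasure lborel (ball c r) \<le> emeasure lborel (cball c r)"
    by (intro emeasure_mono) auto
  ultimately show "emeasure lborel (cball c r) \<noteq> 0"
    by auto
qed

lemma ennreal_eq_divide_mult:
  fixes a b c d :: ennreal
  assumes "a * b = c * d" "b \<noteq> 0" "b \<noteq> \<top>"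
  shows "a = c / b * d"
proof -
  have "a = a * b / b"
    using assms(2,3) by (simp add: ennreal_mult_divide_eq)
  also have "\<dots> = c / b * d"
    unfolding assms(1) by (simp add: ennreal_times_divide mult.commute)
  finally show ?thesis .
qed

text \<open>The cross identity with \<open>g\<close> the indicator of the unit ball yields one
  factor for all \<open>f\<close>. It is the inverse absolute determinant of \<open>T\<close>, but
  only its existence matters below.\<close>

lemma nn_integral_lborel_linear:
  fixes T :: "'a::euclidean_space \<Rightarrow> 'a"
  assumes "linear T" "inj T"
  obtains c where "\<And>f. f \<in> borel_measurable borel \<Longrightarrow>
    (\<integral>\<^sup>+x. f (T x) \<partial>lborel) = c * (\<integral>\<^sup>+x. f x \<partial>lborel)"
proof
  fix f :: "'a \<Rightarrow> ennreal" assume f: "f \<in> borel_measurable borel"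
  let ?B = "cball 0 1 :: 'a set"
  show "(\<integral>\<^sup>+x. f (T x) \<partial>lborel)
    = (\<integral>\<^sup>+x. indicator ?B (T x) \<partial>lborel) / emeasure lborel ?B * (\<integral>\<^sup>+x. f x \<partial>lborel)"
    using nn_integral_lborel_linear_cross[OF assms f, of "indicator ?B",
        OF borel_measurable_indicator[OF borel_closed[OF closed_cball]]]
    by (intro ennreal_eq_divide_mult) (auto simp: emeasure_lborel_cball_pos_finite)
qed

text \<open>\<open>T x\<close> lies in the unit ball exactly when \<open>x\<close> does, so the
  cross identity with the indicator of that ball forces the factor 1.\<close>

lemma nn_integral_lborel_orthogonal:
  fixes T :: "'a::euclidean_space \<Rightarrow> 'a" and f :: "'a \<Rightarrow> ennreal"
  assumes T: "orthogonal_transformation T" and f: "f \<in> borel_measurable borel"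
  shows "(\<integral>\<^sup>+x. f (T x) \<partial>lborel) = (\<integral>\<^sup>+x. f x \<partial>lborel)"
proof -
  let ?B = "cball 0 1 :: 'a set"
  have "indicator ?B (T x) = (indicator ?B x :: ennreal)" for x
    using orthogonal_transformation_norm[OF T, of x] by (auto split: split_indicator)
  then have "(\<integral>\<^sup>+x. f (T x) \<partial>lborel) * emeasure lborel ?B = emeasure lborel ?B * (\<integral>\<^sup>+x. f x \<partial>lborel)"
    using nn_integral_lborel_linear_cross[OF orthogonal_transformation_linear[OF T]
        orthogonal_transformation_inj[OF T] f, of "indicator ?B",
        OF borel_measurable_indicator[OF borel_closed[OF closed_cball]]] by simp
  then have "(\<integral>\<^sup>+x. f (T x) \<partial>lborel)
      = emeasure lborel ?B / emeasure lborel ?B * (\<integral>\<^sup>+x. f x \<partial>lborel)"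
    by (rule ennreal_eq_divide_mult) (auto simp: emeasure_lborel_cball_pos_finite)
  then show ?thesis
    by (subst (asm) ennreal_divide_self)
      (auto simp: emeasure_lborel_cball_pos_finite less_top[symmetric])
qed

section \<open>Spherical laws\<close>

text \<open>The order of quantifiers matters: \<open>c\<close> is fixed by \<psi> before the radial
  weight is chosen, so that different spherical densities can share it.\<close>

lemma nn_integral_radial_times_homogeneous:
  fixes \<psi> :: "'a::euclidean_space \<Rightarrow> ennreal"
  assumes [measurable]: "\<psi> \<in> borel_measurable borel"
    and bound: "\<And>x. \<psi> x \<le> 1" and hom: "\<And>r x. 0 < r \<Longrightarrow> \<psi> (r *\<^sub>R x) = \<psi> x"
  shows "\<exists>c. \<forall>w\<in>borel_measurable borel. (\<forall>x y. norm x = norm y \<longrightarrow> w x = w y) \<longrightarrow>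
    (\<integral>\<^sup>+x. w x * \<psi> x \<partial>lborel) = c * (\<integral>\<^sup>+x. w x \<partial>lborel)"
proof (intro exI ballI impI)
  let ?B = "cball 0 1 :: 'a set"
  define K where "K = emeasure lborel ?B"
  define K' where "K' = (\<integral>\<^sup>+x. \<psi> x * indicator ?B x \<partial>lborel)"
  \<comment> \<open>\<open>R\<close> and \<open>R'\<close> are the images under the norm of \<psi>
    dx and of dx. Each is weighted with the unit-ball mass of the other, so that equality can be
    shown without dividing.\<close>
  define R where "R = scale_measure K (distr (density lborel \<psi>) borel norm)"
  define R' where "R' = scale_measure K' (distr lborel (borel :: real measure) (norm :: 'a \<Rightarrow> real))"
  have K: "K \<noteq> 0" "K \<noteq> \<top>"
    by (auto simp: K_def emeasure_lborel_cball_pos_finite)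
  have "K' \<le> (\<integral>\<^sup>+x. indicator ?B x \<partial>lborel)"
    unfolding K'_def using bound by (intro nn_integral_mono) (auto split: split_indicator)
  then have K': "K' \<noteq> \<top>"
    using K by (auto simp: K_def top_unique)
  have distr: "emeasure (distr lborel borel (norm :: 'a \<Rightarrow> real)) {..r} = emeasure lborel (cball (0::'a) r)" for r
    by (simp add: emeasure_distr cball_def vimage_def)
  have distr': "emeasure (distr (density lborel \<psi>) borel norm) {..r}
      = (\<integral>\<^sup>+x. \<psi> x * indicator (cball 0 r) x \<partial>lborel)" for r
    by (simp add: emeasure_distr emeasure_density cball_def vimage_def)
  have Req: "emeasure R {..r} = emeasure R' {..r}" for r
  proof (cases "0 < r")
    \<comment> \<open>Division by \<open>r\<close> carries the ball of radius \<open>r\<close> to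
      the unit ball and leaves \<psi> unchanged, so both masses are their unit-ball values times the
      same \<open>c\<close>.\<close>
    case True
    obtain c where c: "\<And>f. f \<in> borel_measurable borel \<Longrightarrow>
        (\<integral>\<^sup>+x. f ((1 / r) *\<^sub>R x) \<partial>lborel) = c * (\<integral>\<^sup>+x. f (x :: 'a) \<partial>lborel)"
      using True by (elim nn_integral_lborel_linear[rotated 2])
        (auto intro!: linear_scale_self injI)
    have ind: "indicator ?B ((1 / r) *\<^sub>R x) = (indicator (cball 0 r) x :: ennreal)" for x :: 'a
      using True by (auto simp: field_simps split: split_indicator)
    have [measurable]: "?B \<in> sets borel"
      by simp
    have m: "(\<lambda>x. \<psi> x * indicator ?B x) \<in> borel_measurable borel"
      by measurable
    have "(\<integral>\<^sup>+x. \<psi> x * indicator (cball 0 r) x \<partial>lborel) = c * K'"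
      using c[of "\<lambda>x. \<psi> x * indicator ?B x", OF m] True hom[of "1 / r"] by (simp add: ind K'_def)
    moreover have "emeasure lborel (cball (0 :: 'a) r) = c * K"
      using c[of "indicator ?B"] True by (simp add: ind K_def)
    ultimately show ?thesis
      by (simp add: R_def R'_def distr distr' mult_ac)
  next
    \<comment> \<open>For r \<le> 0 the ball is empty or the origin alone, and both masses
      vanish.\<close>
    case False
    then have sub: "cball (0 :: 'a) r \<subseteq> {0}"
      using norm_le_zero_iff by fastforce
    then have "cball (0 :: 'a) r \<in> null_sets lborel"
      by (rule null_sets_subset[rotated 2]) (auto simp: null_sets_def)
    then have "(\<integral>\<^sup>+x. \<psi> x * indicator (cball 0 r) x \<partial>lborel) = 0"
      by (simp add: nn_integral_null_set)
    with \<open>cball (0 :: 'a) r \<in> null_sets lborel\<close> show ?thesis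
      by (simp add: R_def R'_def distr distr' null_setsD1)
  qed
  have RR: "R = R'"
  proof (rule measure_eqI_generator_eq[where E="range atMost" and \<Omega>=UNIV and A="\<lambda>n. {..real n}"])
    show "Int_stable (range (atMost :: real \<Rightarrow> _))"
      by (auto simp: Int_stable_def)
    show "sets R = sigma_sets UNIV (range atMost)" "sets R' = sigma_sets UNIV (range atMost)"
      by (simp_all add: R_def R'_def borel_eq_atMost)
    show "(\<Union>n. {..real n}) = UNIV"
      by (auto intro: real_arch_simple)
    show "emeasure R {..real n} \<noteq> \<infinity>" for n
      using K' emeasure_lborel_cball_finite[of "0::'a" "real n"]
      by (auto simp: Req R'_def distr ennreal_mult_eq_top_iff)
  qed (use Req in auto)
  fix w :: "'a \<Rightarrow> ennreal"
  assume [measurable]: "w \<in> borel_measurable borel"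
    and rad: "\<forall>x y. norm x = norm y \<longrightarrow> w x = w y"
  \<comment> \<open>A radial \<open>w\<close> is determined by its values along the ray through a
    unit vector, so its integral is an integral against the image measure under the norm.\<close>
  obtain e :: 'a where e: "norm e = 1"
    using norm_Basis SOME_Basis by blast
  have w: "w (norm x *\<^sub>R e) = w x" for x
    using e by (intro rad[rule_format]) simp
  have "(\<integral>\<^sup>+r. w (r *\<^sub>R e) \<partial>R) = (\<integral>\<^sup>+r. w (r *\<^sub>R e) \<partial>R')"
    by (simp add: RR)
  then have "K * (\<integral>\<^sup>+x. \<psi> x * w x \<partial>lborel) = K' * (\<integral>\<^sup>+x. w x \<partial>lborel)"
    unfolding R_def R'_def
    by (simp add: nn_integral_scale_measure nn_integral_distr nn_integral_density w)
  then show "(\<integral>\<^sup>+x. w x * \<psi> x \<partial>lborel) = K' / K * (\<integral>\<^sup>+x. w x \<partial>lborel)"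
    by (intro ennreal_eq_divide_mult) (auto simp: K mult.commute)
qed

text \<open>The product collapses to (2 pi)^(-p/2) exp(-(norm z)^2 / 2).\<close>

lemma std_normal_vec_density_radial:
  fixes x y :: "real ^ 'p"
  assumes "norm x = norm y"
  shows "(\<Prod>i\<in>UNIV. std_normal_density (x $ i)) = (\<Prod>i\<in>UNIV. std_normal_density (y $ i))"
proof -
  have "(\<Prod>i\<in>UNIV. std_normal_density (z $ i))
      = (1 / sqrt (2 * pi)) ^ CARD('p) * exp (- (norm z)\<^sup>2 / 2)" for z :: "real ^ 'p"
    unfolding std_normal_density_def
    by (simp add: prod.distrib exp_sum[symmetric] sum_divide_distrib sum_negf
        norm_vec_def L2_set_def sum_nonneg power_divide prod_dividef)
  then show ?thesis
    using assms by simp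
qed

text \<open>Writing coordinates as inner products with the axis vectors splits the integral into
  one-dimensional factors, each equal to 1.\<close>

lemma prob_space_std_normal_vec: "prob_space (std_normal_vec :: (real ^ 'p) measure)"
proof
  have *: "(\<Prod>i\<in>UNIV. ennreal (std_normal_density (x $ i)))
      = (\<Prod>b\<in>Basis. ennreal (std_normal_density (x \<bullet> b)))" for x :: "real ^ 'p"
  proof -
    have B: "(Basis :: (real ^ 'p) set) = (\<lambda>i. axis i 1) ` UNIV"
      by (auto simp: Basis_vec_def)
    show ?thesis
      unfolding B by (subst prod.reindex) (auto simp: inj_on_def axis_eq_axis inner_axis)
  qed
  have one: "(\<integral>\<^sup>+x. std_normal_density x \<partial>lborel) = 1"
    by (subst nn_integral_eq_integral) auto
  have "emeasure (std_normal_vec :: (real ^ 'p) measure) (space std_normal_vec)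
      = (\<integral>\<^sup>+x. (\<Prod>b\<in>Basis. ennreal (std_normal_density (x \<bullet> b))) \<partial>(lborel :: (real ^ 'p) measure))"
    by (simp add: std_normal_vec_def emeasure_density prod_ennreal[symmetric] *)
  also have "\<dots> = 1"
    by (subst nn_integral_lborel_prod) (auto simp: one)
  finally show "emeasure (std_normal_vec :: (real ^ 'p) measure) (space std_normal_vec) = 1" .
qed

text \<open>The density is composed with the inverse \<open>S\<close> of the affine map. The
  Jacobian factor \<open>c\<close> stays unspecified, since only the shape of the image density is
  used.\<close>

lemma distr_density_lborel_affine:
  fixes T S :: "'a::euclidean_space \<Rightarrow> 'a"
  assumes T: "linear T" "inj T"
    and S: "\<And>x. S (T x + b) = x"
    and [measurable]: "S \<in> borel_measurable borel" "g \<in> borel_measurable borel"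
  obtains c where "distr (density lborel g) borel (\<lambda>x. T x + b) = density lborel (\<lambda>z. c * g (S z))"
proof -
  have [measurable]: "T \<in> borel_measurable borel"
    using T(1) by (rule borel_measurable_linear)
  obtain c where c: "\<And>f. f \<in> borel_measurable borel \<Longrightarrow>
      (\<integral>\<^sup>+x. f (T x) \<partial>lborel) = c * (\<integral>\<^sup>+x. f x \<partial>lborel)"
    using nn_integral_lborel_linear[OF T] by blast
  have "distr (density lborel g) borel (\<lambda>x. T x + b) = density lborel (\<lambda>z. c * g (S z))"
  proof (rule measure_eqI)
    fix E assume "E \<in> sets (distr (density lborel g) borel (\<lambda>x. T x + b))"
    then have [measurable]: "E \<in> sets borel" by simp
    have "emeasure (distr (density lborel g) borel (\<lambda>x. T x + b)) E
        = (\<integral>\<^sup>+x. g (S (T x + b)) * indicator E (T x + b) \<partial>lborel)"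
      by (simp add: nn_integral_indicator[symmetric] nn_integral_distr nn_integral_density S
          del: nn_integral_indicator)
    also have "\<dots> = c * (\<integral>\<^sup>+z. g (S (z + b)) * indicator E (z + b) \<partial>lborel)"
      by (rule c) measurable
    also have "\<dots> = c * (\<integral>\<^sup>+z. g (S z) * indicator E z \<partial>lborel)"
      using nn_integral_lborel_reflect_translate[of "\<lambda>z. g (S z) * indicator E z" 1 b]
      by (simp add: add.commute)
    also have "\<dots> = emeasure (density lborel (\<lambda>z. c * g (S z))) E"
      by (simp add: emeasure_density nn_integral_cmult[symmetric] mult.assoc)
    finally show "emeasure (distr (density lborel g) borel (\<lambda>x. T x + b)) E
        = emeasure (density lborel (\<lambda>z. c * g (S z))) E" .
  qed simp
  then show ?thesis
    using that by blast
qed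

lemma distr_density_lborel_orthogonal:
  fixes T :: "'a::euclidean_space \<Rightarrow> 'a"
  assumes T: "orthogonal_transformation T"
    and [measurable]: "g \<in> borel_measurable borel"
    and g: "\<And>x y. norm x = norm y \<Longrightarrow> g x = g y"
  shows "distr (density lborel g) borel T = density lborel g"
proof (rule measure_eqI)
  have [measurable]: "T \<in> borel_measurable borel"
    using orthogonal_transformation_linear[OF T] by (rule borel_measurable_linear)
  have gT: "g (T x) = g x" for x
    using orthogonal_transformation_norm[OF T] by (rule g)
  fix E assume "E \<in> sets (distr (density lborel g) borel T)"
  then have [measurable]: "E \<in> sets borel" by simp
  have "emeasure (distr (density lborel g) borel T) E = (\<integral>\<^sup>+x. g (T x) * indicator E (T x) \<partial>lborel)"
    by (simp add: nn_integral_indicator[symmetric] nn_integral_distr nn_integral_density gT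
        del: nn_integral_indicator)
  also have "\<dots> = emeasure (density lborel g) E"
    by (subst nn_integral_lborel_orthogonal[OF T]) (auto simp: emeasure_density)
  finally show "emeasure (distr (density lborel g) borel T) E = emeasure (density lborel g) E" .
qed simp

text \<open>Radiality is required pointwise of a chosen version of the density, so no exceptional
  null sets arise.\<close>

locale spherical_law =
  fixes N :: "(real ^ 'p) measure" and g :: "real ^ 'p \<Rightarrow> ennreal"
  assumes N_eq: "N = density lborel g"
    and g_measurable [measurable]: "g \<in> borel_measurable borel"
    and g_radial: "norm x = norm y \<Longrightarrow> g x = g y"
    and prob: "prob_space N"

sublocale spherical_law \<subseteq> prob_space N
  by (rule prob)

context spherical_law begin

lemma sets_N [measurable_cong, simp]: "sets N = sets borel"
  by (simp add: N_eq)

lemma integrable_N: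
  fixes f :: "real ^ 'p \<Rightarrow> 'b::{banach, second_countable_topology}"
  assumes "f \<in> borel_measurable borel" "\<And>x. norm (f x) \<le> B"
  shows "integrable N f"
  using assms by (intro integrable_const_bound[where B=B]) auto

lemma distr_orthogonal: "orthogonal_transformation T \<Longrightarrow> distr N borel T = N"
  unfolding N_eq by (rule distr_density_lborel_orthogonal[OF _ g_measurable g_radial])

text \<open>\<open>T\<close> preserves \<open>N\<close>, so substitution turns the integral into its
  own negative.\<close>

lemma integral_odd_eq_0:
  fixes f :: "real ^ 'p \<Rightarrow> real"
  assumes T: "orthogonal_transformation T" and [measurable]: "f \<in> borel_measurable borel"
    and odd: "\<And>x. f (T x) = - f x"
  shows "(LINT x|N. f x) = 0"
proof -
  have [measurable]: "T \<in> borel_measurable borel"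
    using orthogonal_transformation_linear[OF T] by (rule borel_measurable_linear)
  have "(LINT x|N. f x) = (LINT x|distr N borel T. f x)"
    by (simp add: distr_orthogonal T)
  also have "\<dots> = (LINT x|N. f (T x))"
    by (rule integral_distr) auto
  finally show ?thesis
    by (simp add: odd)
qed

end

text \<open>Norm and direction are independent under a spherical law, and the law of the direction does
  not depend on the spherical law.\<close>

lemma spherical_law_integral_radial_times_homogeneous:
  fixes w \<psi> :: "real ^ 'p \<Rightarrow> real"
  assumes "spherical_law N g" "spherical_law G \<gamma>"
    and [measurable]: "w \<in> borel_measurable borel" "\<psi> \<in> borel_measurable borel"
    and w: "\<And>x. 0 \<le> w x" "\<And>x. w x \<le> B" "\<And>x y. norm x = norm y \<Longrightarrow> w x = w y"
    and \<psi>: "\<And>x. 0 \<le> \<psi> x" "\<And>x. \<psi> x \<le> 1" "\<And>r x. 0 < r \<Longrightarrow> \<psi> (r *\<^sub>R x) = \<psi> x"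
  shows "(LINT x|N. w x * \<psi> x) = (LINT x|N. w x) * (LINT x|G. \<psi> x)"
proof -
  interpret N: spherical_law N g by fact
  interpret G: spherical_law G \<gamma> by fact
  have "\<exists>c. \<forall>v\<in>borel_measurable borel. (\<forall>x y. norm x = norm y \<longrightarrow> v x = v y) \<longrightarrow>
    (\<integral>\<^sup>+x. v x * ennreal (\<psi> x) \<partial>lborel) = c * (\<integral>\<^sup>+x. v x \<partial>lborel)"
    by (rule nn_integral_radial_times_homogeneous) (auto simp: \<psi>)
  then obtain c where c: "\<And>v. v \<in> borel_measurable borel \<Longrightarrow> \<forall>x y. norm x = norm y \<longrightarrow> v x = v y \<Longrightarrow>
    (\<integral>\<^sup>+x. v x * ennreal (\<psi> x) \<partial>lborel) = c * (\<integral>\<^sup>+x. v x \<partial>lborel)"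
    by blast
  have "(\<integral>\<^sup>+x. \<psi> x \<partial>G) = (\<integral>\<^sup>+x. \<gamma> x * \<psi> x \<partial>lborel)"
    by (simp add: G.N_eq nn_integral_density)
  also have "\<dots> = c * (\<integral>\<^sup>+x. \<gamma> x \<partial>lborel)"
    by (intro c allI impI G.g_radial) simp_all
  also have "(\<integral>\<^sup>+x. \<gamma> x \<partial>lborel) = 1"
    using G.emeasure_space_1 by (simp add: G.N_eq emeasure_density)
  \<comment> \<open>The radial weight \<gamma> has total mass 1, which identifies \<open>c\<close>
    as the mean of \<psi> under \<open>G\<close>.\<close>
  finally have c_eq: "c = (\<integral>\<^sup>+x. \<psi> x \<partial>G)" by simp
  have "(\<integral>\<^sup>+x. ennreal (w x * \<psi> x) \<partial>N) = (\<integral>\<^sup>+x. (g x * w x) * \<psi> x \<partial>lborel)"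
    by (simp add: N.N_eq nn_integral_density ennreal_mult w(1) \<psi>(1) mult.assoc)
  \<comment> \<open>The same \<open>c\<close> serves the weight \<open>g * w\<close>, where
    \<open>g\<close> is the density of \<open>N\<close>.\<close>
  also have "\<dots> = c * (\<integral>\<^sup>+x. g x * w x \<partial>lborel)"
    by (intro c allI impI arg_cong2[where f="(*)"] arg_cong[where f=ennreal] N.g_radial w(3)) simp_all
  also have "(\<integral>\<^sup>+x. g x * w x \<partial>lborel) = (\<integral>\<^sup>+x. w x \<partial>N)"
    by (simp add: N.N_eq nn_integral_density)
  finally have eq: "(\<integral>\<^sup>+x. ennreal (w x * \<psi> x) \<partial>N) = (\<integral>\<^sup>+x. \<psi> x \<partial>G) * (\<integral>\<^sup>+x. w x \<partial>N)"
    unfolding c_eq .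
  have wpsi: "w x * \<psi> x \<le> B" for x
    using mult_mono[OF w(2) \<psi>(2) _ \<psi>(1), of x x] w(1) order_trans[OF w(1) w(2)] by simp
  have "integrable N w" "integrable N (\<lambda>x. w x * \<psi> x)" "integrable G \<psi>"
    using w(1,2) \<psi>(1,2) wpsi by (auto intro!: N.integrable_N[where B=B] G.integrable_N[where B=1])
  with eq show ?thesis
    using w(1) \<psi>(1) by (simp add: nn_integral_eq_integral ennreal_mult[symmetric] mult.commute
        ennreal_inj integral_nonneg_AE)
qed

lemma spherical_law_std_normal:
  "spherical_law (std_normal_vec :: (real ^ 'p) measure)
     (\<lambda>z. ennreal (\<Prod>i\<in>UNIV. std_normal_density (z $ i)))"
proof (rule spherical_law.intro)
  show "std_normal_vec = density lborel (\<lambda>z :: real ^ 'p. ennreal (\<Prod>i\<in>UNIV. std_normal_density (z $ i)))"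
    by (rule std_normal_vec_def)
  show "norm x = norm y \<Longrightarrow> ennreal (\<Prod>i\<in>UNIV. std_normal_density (x $ i))
      = ennreal (\<Prod>i\<in>UNIV. std_normal_density (y $ i))" for x y :: "real ^ 'p"
    by (rule arg_cong[OF std_normal_vec_density_radial])
qed (auto simp: prob_space_std_normal_vec)

section \<open>The sign of a scaled vector\<close>

lemma diag_mat_mult_vec: "diag_mat v *v x = (\<chi> i. v $ i * x $ i)"
  by (simp add: vec_eq_iff diag_mat_def matrix_vector_mult_def if_distrib if_distribR sum.delta' cong: if_cong)

definition flip_coord :: "'p \<Rightarrow> real ^ 'p \<Rightarrow> real ^ 'p" where
  "flip_coord k x = (\<chi> i. if i = k then - x $ i else x $ i)"

lemma orthogonal_transformation_flip_coord: "orthogonal_transformation (flip_coord k :: real ^ 'p \<Rightarrow> real ^ 'p)"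
  unfolding orthogonal_transformation
proof
  show "linear (flip_coord k :: real ^ 'p \<Rightarrow> real ^ 'p)"
    by (rule linearI) (auto simp: flip_coord_def vec_eq_iff)
  show "\<forall>v :: real ^ 'p. norm (flip_coord k v) = norm v"
    unfolding norm_vec_def flip_coord_def by (auto intro!: arg_cong[where f="\<lambda>f. L2_set f UNIV"])
qed

lemma sgn_orthogonal_transformation:
  "orthogonal_transformation T \<Longrightarrow> sgn (T x) = T (sgn x)"
  by (simp add: sgn_div_norm orthogonal_transformation_norm linear_scale orthogonal_transformation_linear)

text \<open>At the value of \<open>Z\<close> this is the spatial sign of X - \<mu> in the
  eigenbasis, that is, before rotation by \<Gamma>.\<close>

definition scaled_sign :: "real ^ 'p \<Rightarrow> real ^ 'p \<Rightarrow> real ^ 'p" where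
  "scaled_sign lam z = sgn (diag_mat (\<chi> i. sqrt (lam $ i)) *v z)"

text \<open>Diagonal scaling commutes with coordinate reflections, and the sign commutes with every
  orthogonal map.\<close>

lemma scaled_sign_flip_coord: "scaled_sign lam (flip_coord k z) = flip_coord k (scaled_sign lam z)"
proof -
  have "diag_mat (\<chi> i. sqrt (lam $ i)) *v flip_coord k z = flip_coord k (diag_mat (\<chi> i. sqrt (lam $ i)) *v z)"
    by (simp add: diag_mat_mult_vec flip_coord_def vec_eq_iff)
  then show ?thesis
    by (simp add: scaled_sign_def sgn_orthogonal_transformation orthogonal_transformation_flip_coord)
qed

lemma scaled_sign_scaleR: "0 < r \<Longrightarrow> scaled_sign lam (r *\<^sub>R z) = scaled_sign lam z"
  by (simp add: scaled_sign_def matrix_vector_mult_scaleR sgn_scaleR)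

lemma abs_scaled_sign_le_1: "\<bar>scaled_sign lam z $ i\<bar> \<le> 1"
  using component_le_norm_cart[of "scaled_sign lam z" i] norm_sgn[of "diag_mat (\<chi> i. sqrt (lam $ i)) *v z"]
  by (auto simp: scaled_sign_def split: if_splits)

lemma scaled_sign_measurable [measurable]: "scaled_sign lam \<in> borel_measurable borel"
proof -
  have "(\<lambda>z. diag_mat (\<chi> i. sqrt (lam $ i)) *v z) \<in> borel_measurable borel"
    by (intro borel_measurable_continuous_onI linear_continuous_on matrix_vector_mul_bounded_linear)
  then show ?thesis
    unfolding scaled_sign_def[abs_def] sgn_div_norm by measurable
qed

lemma scaled_sign_component_measurable [measurable]:
  "(\<lambda>z. scaled_sign lam z $ i) \<in> borel_measurable borel"
  using measurable_compose[OF scaled_sign_measurable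
      borel_measurable_continuous_onI[OF linear_continuous_on[OF bounded_linear_vec_nth]]] .

text \<open>The denominator is the squared norm of the scaled vector. At \<open>z = 0\<close> both
  sides are 0, division by zero giving 0.\<close>

lemma scaled_sign_component_mult:
  assumes "\<forall>i. 0 < lam $ i"
  shows "scaled_sign lam z $ i * scaled_sign lam z $ j
    = sqrt (lam $ i) * z $ i * (sqrt (lam $ j) * z $ j) / (\<Sum>k\<in>UNIV. lam $ k * (z $ k)\<^sup>2)"
proof -
  have "(norm (diag_mat (\<chi> i. sqrt (lam $ i)) *v z))\<^sup>2 = (\<Sum>k\<in>UNIV. lam $ k * (z $ k)\<^sup>2)"
    using assms by (simp add: diag_mat_mult_vec norm_vec_def L2_set_def sum_nonneg power_mult_distrib less_imp_le)
  then show ?thesis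
    by (simp add: scaled_sign_def sgn_div_norm diag_mat_mult_vec divide_inverse power2_eq_square
        mult_ac flip: inverse_mult_distrib)
qed

section \<open>Entries of the sign matrix\<close>

lemma diag_mat_mult_left: "(diag_mat v ** A) $ i $ j = v $ i * A $ i $ j"
  by (simp add: diag_mat_def matrix_matrix_mult_def if_distrib if_distribR sum.delta' cong: if_cong)

lemma diag_mat_mult_right: "(A ** diag_mat v) $ i $ j = A $ i $ j * v $ j"
  by (simp add: diag_mat_def matrix_matrix_mult_def if_distrib if_distribR sum.delta' cong: if_cong)

text \<open>The sign matrix is the outer square of the scaled sign; boundedness, measurability and
  behavior under reflections are read off from this form.\<close>

lemma sign_matrix_component:
  assumes "\<forall>i. 0 < lam $ i"
  shows "sign_matrix lam z $ i $ j = scaled_sign lam z $ i * scaled_sign lam z $ j"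
proof -
  have "z \<bullet> (diag_mat lam *v z) = (\<Sum>k\<in>UNIV. lam $ k * (z $ k)\<^sup>2)"
    by (simp add: diag_mat_mult_vec inner_vec_def power2_eq_square mult_ac)
  moreover have "(diag_mat s ** (columnvector z :: real ^ 1 ^ _) ** (rowvector z :: real ^ _ ^ 1)) $ i $ j
      = s $ i * z $ i * z $ j" for s
    by (simp add: matrix_matrix_mult_def[of "diag_mat s ** _"] diag_mat_mult_left
        columnvector_def rowvector_def sum_1)
  ultimately show ?thesis
    by (simp add: sign_matrix_def scaled_sign_component_mult[OF assms] diag_mat_mult_right mult_ac)
qed

lemma sign_matrix_eq:
  fixes lam :: "real ^ 'p"
  assumes "\<forall>i. 0 < lam $ i"
  shows "sign_matrix lam z = (\<chi> i j. scaled_sign lam z $ i * scaled_sign lam z $ j)"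
  by (simp add: vec_eq_iff sign_matrix_component[OF assms])

lemma sign_matrix_measurable:
  fixes lam :: "real ^ 'p"
  assumes "\<forall>i. 0 < lam $ i"
  shows "sign_matrix lam \<in> borel_measurable borel"
proof -
  have "(\<lambda>s :: real ^ 'p. \<chi> i j. s $ i * s $ j) \<in> borel_measurable borel"
    by (intro borel_measurable_continuous_onI continuous_on_vec_lambda continuous_intros)
  from measurable_compose[OF scaled_sign_measurable this]
  show ?thesis
    unfolding sign_matrix_eq[OF assms, abs_def] .
qed

text \<open>Links the single matrix-valued integral in \<open>Lambda_DS\<close> to scalar integrals:
  reading an entry is bounded linear.\<close>

lemma integral_vec_component:
  fixes f :: "'a \<Rightarrow> real ^ 'n ^ 'n"
  assumes "integrable M f"
  shows "(LINT x|M. f x) $ i $ j = (LINT x|M. f x $ i $ j)"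
  using integral_bounded_linear[OF bounded_linear_compose[OF bounded_linear_vec_nth bounded_linear_vec_nth] assms, of i j]
  by simp

section \<open>Moments of radially weighted signs\<close>

context spherical_law begin

text \<open>Reflecting coordinate \<open>i\<close> keeps \<open>w\<close> and changes the sign of
  component \<open>i\<close> alone, so both integrands are odd, the second one because
  \<open>j\<close> differs from \<open>i\<close>.\<close>

lemma integral_radial_scaled_sign_eq_0:
  assumes [measurable]: "w \<in> borel_measurable borel"
    and w: "\<And>x y. norm x = norm y \<Longrightarrow> w x = w y"
  shows "(LINT z|N. w z * scaled_sign lam z $ i) = 0"
    and "i \<noteq> j \<Longrightarrow> (LINT z|N. w z * (scaled_sign lam z $ i * scaled_sign lam z $ j)) = 0"
proof -
  have "w (flip_coord i z) = w z" for z
    by (rule w) (simp add: orthogonal_transformation_norm orthogonal_transformation_flip_coord)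
  note odd = this scaled_sign_flip_coord flip_coord_def[of i "scaled_sign lam _"]
  show "(LINT z|N. w z * scaled_sign lam z $ i) = 0"
    by (rule integral_odd_eq_0[OF orthogonal_transformation_flip_coord[of i]]) (measurable, simp add: odd)
  show "i \<noteq> j \<Longrightarrow> (LINT z|N. w z * (scaled_sign lam z $ i * scaled_sign lam z $ j)) = 0"
    by (rule integral_odd_eq_0[OF orthogonal_transformation_flip_coord[of i]]) (measurable, simp add: odd)
qed

lemma integral_radial_sign_matrix:
  assumes lam: "\<forall>i. 0 < lam $ i" and [measurable]: "w \<in> borel_measurable borel"
    and w: "\<And>x. \<bar>w x\<bar> \<le> B" "\<And>x y. norm x = norm y \<Longrightarrow> w x = w y"
  shows "(LINT z|N. w z *\<^sub>R sign_matrix lam z)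
    = diag_mat (\<chi> i. LINT z|N. w z * (scaled_sign lam z $ i)\<^sup>2)"
proof -
  have bound: "\<bar>scaled_sign lam z $ i * scaled_sign lam z $ j\<bar> \<le> 1" for z i j
    using mult_mono[OF abs_scaled_sign_le_1 abs_scaled_sign_le_1, of lam z j lam z i] by (simp add: abs_mult)
  have int: "integrable N (\<lambda>z. w z *\<^sub>R sign_matrix lam z)"
  proof (rule integrable_N)
    show "(\<lambda>z. w z *\<^sub>R sign_matrix lam z) \<in> borel_measurable borel"
      using sign_matrix_measurable[OF lam] by measurable
    fix z
    \<comment> \<open>The norm is at most the sum of the absolute entries, each bounded by 1; the
      double sum of ones is the squared dimension.\<close>
    have "norm (sign_matrix lam z) \<le> (\<Sum>i\<in>UNIV. \<Sum>j\<in>UNIV. \<bar>sign_matrix lam z $ i $ j\<bar>)"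
      unfolding norm_vec_def[of "sign_matrix lam z"]
      by (intro order_trans[OF L2_set_le_sum] sum_mono norm_le_l1_cart) simp
    also have "\<dots> \<le> (\<Sum>i\<in>(UNIV::'p set). \<Sum>j\<in>(UNIV::'p set). 1)"
      using bound by (intro sum_mono) (simp add: sign_matrix_component[OF lam])
    finally show "norm (w z *\<^sub>R sign_matrix lam z) \<le> B * (\<Sum>i\<in>(UNIV::'p set). \<Sum>j\<in>(UNIV::'p set). 1)"
      using w(1)[of z] by (auto intro!: mult_mono)
  qed
  show ?thesis
    unfolding vec_eq_iff integral_vec_component[OF int]
    using integral_radial_scaled_sign_eq_0(2)[OF assms(2) w(2)]
    by (simp add: sign_matrix_component[OF lam] diag_mat_def power2_eq_square)
qed

end

section \<open>The covariance matrix of the rank vector\<close>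

text \<open>\<open>A\<close> is the map that recovers X - \<mu> from \<open>Z\<close>; it factors
  the covariance parameter and can be inverted.\<close>

lemma rotated_diag_mult_transpose:
  assumes "orthogonal_matrix \<Gamma>" "\<forall>i. 0 < lam $ i"
  defines "A \<equiv> \<Gamma> ** diag_mat (\<chi> i. sqrt (lam $ i))"
  shows "A ** transpose A = \<Gamma> ** diag_mat lam ** transpose \<Gamma>" and "invertible A"
proof -
  have tr: "transpose (diag_mat v) = diag_mat v" for v :: "real ^ 'a"
    by (auto simp: vec_eq_iff transpose_def diag_mat_def)
  have "diag_mat (\<chi> i. sqrt (lam $ i)) ** diag_mat (\<chi> i. sqrt (lam $ i)) = diag_mat lam"
    using assms(2)
    by (simp add: vec_eq_iff diag_mat_mult_left) (auto simp: diag_mat_def less_imp_le)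
  then show "A ** transpose A = \<Gamma> ** diag_mat lam ** transpose \<Gamma>"
    unfolding A_def matrix_transpose_mul tr by (metis matrix_mul_assoc)
  have "diag_mat (\<chi> i. sqrt (lam $ i)) ** diag_mat (\<chi> i. 1 / sqrt (lam $ i)) = mat 1"
    "diag_mat (\<chi> i. 1 / sqrt (lam $ i)) ** diag_mat (\<chi> i. sqrt (lam $ i)) = mat 1"
    using assms(2)
    by (simp_all add: vec_eq_iff diag_mat_mult_left)
      (auto simp: diag_mat_def mat_def less_imp_neq[symmetric])
  then have "invertible (diag_mat (\<chi> i. sqrt (lam $ i)))"
    unfolding invertible_def by blast
  moreover have "invertible \<Gamma>"
    using assms(1) unfolding invertible_def orthogonal_matrix_def by blast
  ultimately show "invertible A"
    unfolding A_def by (rule invertible_mult[rotated])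
qed

lemma matrix_inv_inverse:
  assumes "invertible A"
  shows "A ** matrix_inv A = mat 1" "matrix_inv A ** A = mat 1"
  using someI_ex[OF assms[unfolded invertible_def]] unfolding matrix_inv_def by simp_all

text \<open>This is why the elliptical density becomes radial in \<open>z\<close>. If
  \<open>y\<close> is the inverse matrix applied to \<open>A *v z\<close>, injectivity of
  \<open>A\<close> gives \<open>transpose A *v y = z\<close>, and \<open>A\<close> moves across the
  inner product as its transpose.\<close>

lemma inner_matrix_inv_mult_transpose:
  fixes A :: "real ^ 'n ^ 'n"
  assumes "invertible A"
  shows "(A *v z) \<bullet> (matrix_inv (A ** transpose A) *v (A *v z)) = z \<bullet> z"
proof -
  have "invertible (A ** transpose A)"
    using assms by (intro invertible_mult transpose_invertible)
  then have inv: "A ** transpose A ** matrix_inv (A ** transpose A) = mat 1"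
    by (rule matrix_inv_inverse)
  define y where "y = matrix_inv (A ** transpose A) *v (A *v z)"
  have "A *v (transpose A *v y) = A *v z"
    using inv by (simp add: y_def matrix_vector_mul_assoc matrix_mul_assoc)
  then have "transpose A *v y = z"
    using inj_matrix_vector_mult[OF assms] by (auto dest: injD)
  then have "(A *v z) \<bullet> y = z \<bullet> z"
    by (metis dot_lmul_matrix inner_commute transpose_matrix_vector)
  then show ?thesis
    by (simp add: y_def)
qed

text \<open>Zero means turn covariances into second moments, which expand bilinearly in the rows of
  \<Gamma>.\<close>

lemma cov_matrix_linear_image:
  fixes Y U :: "'a \<Rightarrow> real ^ 'p"
  assumes Y: "\<And>\<omega>. \<omega> \<in> space M \<Longrightarrow> Y \<omega> = \<Gamma> *v U \<omega>"
    and int: "\<And>k. integrable M (\<lambda>\<omega>. U \<omega> $ k)" "\<And>k l. integrable M (\<lambda>\<omega>. U \<omega> $ k * U \<omega> $ l)"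
    and mean: "\<And>k. (LINT \<omega>|M. U \<omega> $ k) = 0"
    and cov: "\<And>k l. (LINT \<omega>|M. U \<omega> $ k * U \<omega> $ l) = L $ k $ l"
  shows "cov_matrix M Y = \<Gamma> ** L ** transpose \<Gamma>"
proof -
  have Yi: "Y \<omega> $ i = (\<Sum>k\<in>UNIV. \<Gamma> $ i $ k * U \<omega> $ k)" if "\<omega> \<in> space M" for \<omega> i
    using Y[OF that] by (simp add: matrix_vector_mult_def)
  have "(LINT \<omega>|M. Y \<omega> $ i) = (LINT \<omega>|M. (\<Sum>k\<in>UNIV. \<Gamma> $ i $ k * U \<omega> $ k))" for i
    by (intro Bochner_Integration.integral_cong) (simp_all add: Yi)
  then have mean_Y: "(LINT \<omega>|M. Y \<omega> $ i) = 0" for i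
    by (simp add: int mean)
  have "(LINT \<omega>|M. Y \<omega> $ i * Y \<omega> $ j)
      = (\<Sum>k\<in>UNIV. \<Sum>l\<in>UNIV. \<Gamma> $ i $ k * \<Gamma> $ j $ l * L $ k $ l)" for i j
  proof -
    have "(LINT \<omega>|M. Y \<omega> $ i * Y \<omega> $ j)
        = (LINT \<omega>|M. (\<Sum>k\<in>UNIV. \<Sum>l\<in>UNIV. \<Gamma> $ i $ k * \<Gamma> $ j $ l * (U \<omega> $ k * U \<omega> $ l)))"
      by (intro Bochner_Integration.integral_cong) (simp_all add: Yi sum_product mult_ac)
    then show ?thesis
      by (simp add: int cov)
  qed
  also have "(\<Sum>k\<in>UNIV. \<Sum>l\<in>UNIV. \<Gamma> $ i $ k * \<Gamma> $ j $ l * L $ k $ l)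
      = (\<Sum>l\<in>UNIV. \<Sum>k\<in>UNIV. \<Gamma> $ i $ k * \<Gamma> $ j $ l * L $ k $ l)" for i j
    by (rule sum.swap)
  finally show ?thesis
    by (simp add: cov_matrix_def mean_Y matrix_matrix_mult_def transpose_def vec_eq_iff
        sum_distrib_left sum_distrib_right mult_ac)
qed

text \<open>An orthogonal map carrying \<open>x\<close> to \<open>y\<close> leaves \<open>N\<close>
  fixed, so affine invariance compares the two depths under one and the same law.\<close>

lemma depth_orthogonal_invariant:
  fixes D :: "real ^ 'p \<Rightarrow> (real ^ 'p) measure \<Rightarrow> real"
  assumes depth: "depth_function \<F> D" and N: "N \<in> \<F>" "spherical_law N g" and "norm x = norm y"
  shows "D x N = D y N"
proof -
  interpret spherical_law N g by fact
  obtain T where T: "orthogonal_transformation T" "T x = y"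
    using orthogonal_transformation_exists[OF \<open>norm x = norm y\<close>] .
  have T_eq: "matrix T *v z + 0 = T z" for z
    using T(1) by (simp add: matrix_works orthogonal_transformation_linear)
  have "invertible (matrix T)"
    using T(1) unfolding orthogonal_transformation_matrix invertible_def orthogonal_matrix_def by blast
  then have "D (matrix T *v x + 0) (distr N borel (\<lambda>x. matrix T *v x + 0)) = D x N"
    using depth N(1) unfolding depth_function_def by blast
  then show ?thesis
    unfolding T_eq T(2) distr_orthogonal[OF T(1)] by simp
qed

text \<open>Substituting \<open>A *v z + \<mu>\<close> into the elliptical density leaves a constant
  times a function of the norm of \<open>z\<close>. The last claim exhibits the law of
  \<open>Z\<close> as an affine image of that of \<open>X\<close>, through which class membership
  and depth values pass.\<close>

lemma elliptical_standardized_spherical: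
  fixes X Z :: "'a \<Rightarrow> real ^ 'p" and A :: "real ^ 'p ^ 'p"
  assumes "prob_space M" and ell: "elliptical M X \<mu> (A ** transpose A)" and A: "invertible A"
    and X_eq: "\<And>\<omega>. \<omega> \<in> space M \<Longrightarrow> X \<omega> = A *v Z \<omega> + \<mu>"
  shows "\<exists>g. spherical_law (distr M borel Z) g" and "Z \<in> borel_measurable M"
    and "distr M borel Z = distr (distr M borel X) borel (\<lambda>x. matrix_inv A *v x + - (matrix_inv A *v \<mu>))"
proof -
  interpret prob_space M by fact
  let ?T = "\<lambda>x. matrix_inv A *v x + - (matrix_inv A *v \<mu>)"
  obtain f where f: "distributed M lborel X
      (\<lambda>x. ennreal (det (A ** transpose A) powr (- 1 / 2)
        * f ((x - \<mu>) \<bullet> (matrix_inv (A ** transpose A) *v (x - \<mu>)))))"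
    using ell unfolding elliptical_def by (elim exE conjE) (rule that)
  define gX where "gX = (\<lambda>x. ennreal (det (A ** transpose A) powr (- 1 / 2)
        * f ((x - \<mu>) \<bullet> (matrix_inv (A ** transpose A) *v (x - \<mu>)))))"
  have "distributed M lborel X gX"
    using f by (simp only: gX_def)
  then have X_distr: "distr M lborel X = density lborel gX"
    and gX [measurable]: "gX \<in> borel_measurable borel" "X \<in> borel_measurable M"
    unfolding distributed_def measurable_lborel1 measurable_lborel2 by blast+
  have inv: "matrix_inv A *v (A *v z) = z" "A *v (matrix_inv A *v z) = z" for z
    using matrix_inv_inverse[OF A] by (simp_all add: matrix_vector_mul_assoc)
  have mv [measurable]: "(\<lambda>x. B *v x) \<in> borel_measurable borel" for B :: "real ^ 'p ^ 'p"
    by (intro borel_measurable_continuous_onI linear_continuous_on matrix_vector_mul_bounded_linear)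
  have Z_eq: "Z \<omega> = ?T (X \<omega>)" if "\<omega> \<in> space M" for \<omega>
    by (simp add: X_eq[OF that] matrix_vector_right_distrib inv)
  have "(\<lambda>\<omega>. ?T (X \<omega>)) \<in> borel_measurable M"
    by measurable
  then show Z: "Z \<in> borel_measurable M"
    by (subst measurable_cong[OF Z_eq])
  show Z_distr: "distr M borel Z = distr (distr M borel X) borel ?T"
    by (subst distr_distr) (auto intro!: distr_cong simp: Z_eq)
  have X_distr': "distr M borel X = density lborel gX"
    unfolding X_distr[symmetric] by (rule distr_cong) simp_all
  obtain c where c: "distr (density lborel gX) borel ?T = density lborel (\<lambda>z. c * gX (A *v z + \<mu>))"
  proof (rule distr_density_lborel_affine)
    show "inj ((*v) (matrix_inv A))"
      by (rule injI) (metis inv(2))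
    show "A *v (matrix_inv A *v x + - (matrix_inv A *v \<mu>)) + \<mu> = x" for x
      by (simp add: matrix_vector_mult_diff_distrib inv)
    show "linear ((*v) (matrix_inv A))"
      by simp
    show "(\<lambda>z. A *v z + \<mu>) \<in> borel_measurable borel"
      by measurable
    show "gX \<in> borel_measurable borel"
      by (rule gX(1))
  qed (rule that)
  have "spherical_law (distr M borel Z) (\<lambda>z. c * gX (A *v z + \<mu>))"
  proof (rule spherical_law.intro)
    show "distr M borel Z = density lborel (\<lambda>z. c * gX (A *v z + \<mu>))"
      unfolding Z_distr X_distr' by (rule c)
    show "prob_space (distr M borel Z)"
      using Z by (rule prob_space_distr)
    show "c * gX (A *v x + \<mu>) = c * gX (A *v y + \<mu>)" if "norm x = norm y" for x y
      using that by (simp add: gX_def inner_matrix_inv_mult_transpose[OF A] dot_square_norm)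
  qed measurable
  then show "\<exists>g. spherical_law (distr M borel Z) g"
    by blast
qed

theorem theorem3p1:
  fixes M :: "'a measure" and X Z :: "'a \<Rightarrow> real ^ 'p"
    and \<mu> lam :: "real ^ 'p" and \<Sigma> \<Gamma> :: "real ^ 'p ^ 'p"
    and \<F> :: "(real ^ 'p) measure set"
    and D :: "real ^ 'p \<Rightarrow> (real ^ 'p) measure \<Rightarrow> real" and h :: "real \<Rightarrow> real"
    and PX PZ :: "(real ^ 'p) measure"
  assumes "prob_space M"
    and "elliptical M X \<mu> \<Sigma>"
    and "orthogonal_matrix \<Gamma>" and "\<forall>i. 0 < lam $ i"
    and "\<Sigma> = \<Gamma> ** diag_mat lam ** transpose \<Gamma>"
    and "\<forall>\<omega>\<in>space M. X \<omega> = (\<Gamma> ** diag_mat (\<chi> i. sqrt (lam $ i))) *v Z \<omega> + \<mu>"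
    and "PX = distr M borel X" and "PZ = distr M borel Z"
    and "depth_function \<F> D" and "PX \<in> \<F>"
    and "htped_transform \<F> D h"
    and "(\<lambda>x. htped h D x PX) \<in> borel_measurable borel"
  shows
    "cov_matrix M (rank_vector h D M X \<mu>) = \<Gamma> ** Lambda_DS h D PZ lam PZ ** transpose \<Gamma>
     \<and> Lambda_DS h D PZ lam PZ = diag_mat (lambda_DS h D PZ lam PZ)
     \<comment> \<open>the direction of \<open>z\<close> may always be taken from \<open>N(0, I)\<close>\<close>
     \<and> Lambda_DS h D PZ lam PZ =
         (LINT z|PZ. (htped h D z PZ)\<^sup>2) *\<^sub>R (LINT z|std_normal_vec. sign_matrix lam z)
     \<comment> \<open>\<open>z\<close> itself may be taken from \<open>N(0, I)\<close> when this is the law of \<open>Z\<close>\<close>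
     \<and> (PZ = std_normal_vec \<longrightarrow>
          cov_matrix M (rank_vector h D M X \<mu>) =
            \<Gamma> ** Lambda_DS h D PZ lam std_normal_vec ** transpose \<Gamma>
          \<and> Lambda_DS h D PZ lam std_normal_vec =
              diag_mat (lambda_DS h D PZ lam std_normal_vec))"
proof -
  note lam = assms(4)
  define A where "A = \<Gamma> ** diag_mat (\<chi> i. sqrt (lam $ i))"
  have A: "A ** transpose A = \<Sigma>" "invertible A"
    using rotated_diag_mult_transpose[OF assms(3,4)] assms(5) by (simp_all add: A_def)
  have X_eq: "X \<omega> = A *v Z \<omega> + \<mu>" if "\<omega> \<in> space M" for \<omega>
    using assms(6) that by (simp add: A_def)
  have ell: "elliptical M X \<mu> (A ** transpose A)"
    using assms(2) A(1) by simp
  note standardized = elliptical_standardized_spherical[OF assms(1) ell A(2) X_eq]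
  obtain g where g: "spherical_law PZ g"
    using standardized(1) assms(8) by auto
  interpret PZ: spherical_law PZ g by (rule g)
  interpret M: prob_space M by (rule assms(1))
  have [measurable]: "Z \<in> borel_measurable M"
    by (rule standardized(2))
  let ?T = "\<lambda>x. matrix_inv A *v x + - (matrix_inv A *v \<mu>)"
  have PZ_eq: "PZ = distr PX borel ?T"
    using standardized(3) assms(7,8) by simp
  have inv: "matrix_inv A ** A = mat 1" "A ** matrix_inv A = mat 1"
    using matrix_inv_inverse[OF A(2)] by simp_all
  then have "invertible (matrix_inv A)"
    unfolding invertible_def by blast
  \<comment> \<open>Affine invariance is applied to the standardizing map from \<open>X\<close> to
    \<open>Z\<close>.\<close>
  with assms(9,10) have PZ_class: "PZ \<in> \<F>" and D_inv: "\<And>x. D (?T x) PZ = D x PX"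
    unfolding depth_function_def PZ_eq by blast+
  define \<phi> where "\<phi> z = htped h D z PZ" for z
  have \<phi>_eq: "\<phi> z = htped h D (A *v z + \<mu>) PX" for z
    using D_inv[of "A *v z + \<mu>"] inv
    by (simp add: \<phi>_def htped_def matrix_vector_right_distrib matrix_vector_mul_assoc)
  \<comment> \<open>The depth axioms do not speak of measurability; that of \<phi> is inherited from
    the assumption on \<open>PX\<close> through this substitution.\<close>
  have "(\<lambda>z. A *v z + \<mu>) \<in> borel_measurable borel"
    by (intro borel_measurable_continuous_onI continuous_on_add linear_continuous_on
        matrix_vector_mul_bounded_linear continuous_on_const)
  from measurable_compose[OF this assms(12)] have [measurable]: "\<phi> \<in> borel_measurable borel"
    by (simp add: \<phi>_eq[abs_def])
  have \<phi>_radial: "\<phi> x = \<phi> y" if "norm x = norm y" for x y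
    unfolding \<phi>_def htped_def depth_orthogonal_invariant[OF assms(9) PZ_class g that] ..
  \<comment> \<open>\<open>h\<close> is bounded from both sides on the depth values, so all moments
    below are finite whatever the tails of \<open>X\<close>.\<close>
  obtain B where B: "\<And>z. \<bar>\<phi> z\<bar> \<le> B"
    using assms(11) PZ_class unfolding htped_transform_def bounded_iff \<phi>_def htped_def by auto
  have "0 \<le> B"
    using B[of 0] by linarith
  have \<phi>2: "\<bar>(\<phi> z)\<^sup>2\<bar> \<le> B\<^sup>2" for z
    using power_mono[OF B[of z], of 2] by simp
  have \<phi>2_radial: "(\<phi> x)\<^sup>2 = (\<phi> y)\<^sup>2" if "norm x = norm y" for x y
    using \<phi>_radial[OF that] by simp
  let ?s = "scaled_sign lam"
  have Lambda: "Lambda_DS h D PZ lam PZ = diag_mat (\<chi> i. LINT z|PZ. (\<phi> z)\<^sup>2 * (?s z $ i)\<^sup>2)"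
    unfolding Lambda_DS_def \<phi>_def[symmetric]
    by (rule PZ.integral_radial_sign_matrix[OF lam _ \<phi>2 \<phi>2_radial]) measurable
  have sq: "(?s z $ i)\<^sup>2 = lam $ i * (z $ i)\<^sup>2 / (\<Sum>j\<in>UNIV. lam $ j * (z $ j)\<^sup>2)" for z i
    using scaled_sign_component_mult[OF lam, of z i i] lam[rule_format, of i]
    by (simp add: abs_of_pos power2_eq_square mult_ac flip: real_sqrt_mult)
  have diag: "Lambda_DS h D PZ lam PZ = diag_mat (lambda_DS h D PZ lam PZ)"
    unfolding Lambda by (simp add: lambda_DS_def \<phi>_def sq mult.assoc)

  interpret G: spherical_law "std_normal_vec :: (real ^ 'p) measure"
    "\<lambda>z. ennreal (\<Prod>i\<in>UNIV. std_normal_density (z $ i))"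
    by (rule spherical_law_std_normal)
  \<comment> \<open>With weight 1 the Gaussian integral is diagonal as well, so the factorization
    has to be checked on diagonal entries only.\<close>
  have "(LINT z|std_normal_vec. 1 *\<^sub>R sign_matrix lam z)
      = diag_mat (\<chi> i. LINT z|std_normal_vec. 1 * (?s z $ i)\<^sup>2)"
    by (rule G.integral_radial_sign_matrix[OF lam, where B=1]) simp_all
  \<comment> \<open>The square of \<phi> is the radial weight; the squared sign component is
    homogeneous of degree 0 with values between 0 and 1.\<close>
  moreover have "(LINT z|PZ. (\<phi> z)\<^sup>2 * (?s z $ i)\<^sup>2)
      = (LINT z|PZ. (\<phi> z)\<^sup>2) * (LINT z|std_normal_vec. (?s z $ i)\<^sup>2)" for i
  proof (rule spherical_law_integral_radial_times_homogeneous[OF g spherical_law_std_normal])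
    show "(\<phi> z)\<^sup>2 \<le> B\<^sup>2" for z
      using \<phi>2[of z] by simp
    show "(?s z $ i)\<^sup>2 \<le> 1" for z
      using power_mono[OF abs_scaled_sign_le_1, of lam z i 2] by simp
    show "(?s (r *\<^sub>R z) $ i)\<^sup>2 = (?s z $ i)\<^sup>2" if "0 < r" for r z
      by (simp add: scaled_sign_scaleR that)
  qed (rule \<phi>2_radial | simp)+
  ultimately have factor: "Lambda_DS h D PZ lam PZ
      = (LINT z|PZ. (htped h D z PZ)\<^sup>2) *\<^sub>R (LINT z|std_normal_vec. sign_matrix lam z)"
    unfolding Lambda by (simp add: \<phi>_def vec_eq_iff diag_mat_def)

  have orth: "orthogonal_transformation ((*v) \<Gamma>)"
    using assms(3) by (simp add: orthogonal_transformation_matrix)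
  have cov: "cov_matrix M (rank_vector h D M X \<mu>) = \<Gamma> ** Lambda_DS h D PZ lam PZ ** transpose \<Gamma>"
  proof (rule cov_matrix_linear_image)
    fix \<omega> assume "\<omega> \<in> space M"
    \<comment> \<open>The sign commutes with the rotation \<Gamma>, and affine invariance moves the
      depth from \<open>X\<close> to \<open>Z\<close>.\<close>
    then have "spatial_sign (X \<omega> - \<mu>) = \<Gamma> *v ?s (Z \<omega>)" "htped h D (X \<omega>) (distr M borel X) = \<phi> (Z \<omega>)"
      using sgn_orthogonal_transformation[OF orth]
      by (simp_all add: X_eq A_def scaled_sign_def \<phi>_eq assms(7) flip: matrix_vector_mul_assoc)
    then show "rank_vector h D M X \<mu> \<omega> = \<Gamma> *v (\<phi> (Z \<omega>) *\<^sub>R ?s (Z \<omega>))"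
      by (simp add: rank_vector_def matrix_vector_mult_scaleR)
  next
    fix k l
    have b: "\<bar>\<phi> z * ?s z $ k\<bar> \<le> B" for z k
      using mult_mono[OF B[of z] abs_scaled_sign_le_1[of lam z k]] \<open>0 \<le> B\<close> by (simp add: abs_mult)
    then have b2: "\<bar>(\<phi> z * ?s z $ k) * (\<phi> z * ?s z $ l)\<bar> \<le> B * B" for z
      unfolding abs_mult[of "\<phi> z * ?s z $ k"] using \<open>0 \<le> B\<close> by (intro mult_mono) auto
    show "integrable M (\<lambda>\<omega>. (\<phi> (Z \<omega>) *\<^sub>R ?s (Z \<omega>)) $ k)"
      using b by (intro M.integrable_const_bound[where B=B]) auto
    show "integrable M (\<lambda>\<omega>. (\<phi> (Z \<omega>) *\<^sub>R ?s (Z \<omega>)) $ k * (\<phi> (Z \<omega>) *\<^sub>R ?s (Z \<omega>)) $ l)"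
      using b2 by (intro M.integrable_const_bound[where B="B * B"]) auto
    have "(LINT \<omega>|M. \<phi> (Z \<omega>) * ?s (Z \<omega>) $ k) = (LINT z|PZ. \<phi> z * ?s z $ k)"
      unfolding assms(8) by (rule integral_distr[symmetric]) measurable
    then show "(LINT \<omega>|M. (\<phi> (Z \<omega>) *\<^sub>R ?s (Z \<omega>)) $ k) = 0"
      using PZ.integral_radial_scaled_sign_eq_0(1)[of \<phi> lam k, OF _ \<phi>_radial] by simp
    have "(LINT \<omega>|M. (\<phi> (Z \<omega>))\<^sup>2 * (?s (Z \<omega>) $ k * ?s (Z \<omega>) $ l))
        = (LINT z|PZ. (\<phi> z)\<^sup>2 * (?s z $ k * ?s z $ l))"
      unfolding assms(8) by (rule integral_distr[symmetric]) measurable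
    \<comment> \<open>Off the diagonal both sides vanish by reflection; on it they are the same
      integral.\<close>
    also have "\<dots> = Lambda_DS h D PZ lam PZ $ k $ l"
      using PZ.integral_radial_scaled_sign_eq_0(2)[of "\<lambda>z. (\<phi> z)\<^sup>2" k l lam, OF _ \<phi>2_radial]
      by (simp add: Lambda diag_mat_def power2_eq_square)
    finally show "(LINT \<omega>|M. (\<phi> (Z \<omega>) *\<^sub>R ?s (Z \<omega>)) $ k * (\<phi> (Z \<omega>) *\<^sub>R ?s (Z \<omega>)) $ l)
        = Lambda_DS h D PZ lam PZ $ k $ l"
      by (simp add: power2_eq_square mult_ac)
  qed
  \<comment> \<open>The Gaussian case follows from \<open>cov\<close> and \<open>diag\<close> by
    replacing \<open>PZ\<close> with \<open>std_normal_vec\<close>.\<close>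
  show ?thesis
    using cov diag factor by metis
qed

end
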